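(* Let $k\ge 1$ be an integer, let $G$ be a finite simple graph, and let $H$ be a hamiltonian subgraph of $G$. Suppose that there exists a vertex $x_0\in V(H)$ with $\deg_H(x_0)\ge k$. Then $H$ (and hence $G$) contains every $k$-spider as a subgraph.
   Context: A spider is a tree with at most one vertex of degree greater than $2$; equivalently, it consists of a root vertex together with $f\ge 1$ paths (legs) $P_1,\dots,P_f$ starting at the root and otherwise pairwise vertex-disjoint. A $k$-spider $S_{\ell_1,\dots,\ell_f}$ is a spider whose legs have lengths (numbers of edges) $\ell_1,\dots,\ell_f\ge 1$ with $\ell_1+\dots+\ell_f=k$, i.e. a spider with $k$ edges. A graph contains a spider if it has a (not necessarily induced) subgraph isomorphic to it. A graph is hamiltonian if it has a cycle through all its vertices. *)

theory Defs
  imports "Graph_Theory.Graph_Theory"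
begin

text \<open>
  A finite simple graph is a \<^locale>\<open>pair_graph\<close>: a finite vertex set with a symmetric,
  irreflexive set of ordered pairs, so that an undirected edge is a pair of opposite arcs. Hence
  the degree of a vertex is its \<^const>\<open>out_degree\<close>, and a subgraph that is itself a
  \<^locale>\<open>pair_graph\<close> is a subgraph in the undirected sense.
\<close>

text \<open>
  In a symmetric digraph \<^const>\<open>pre_digraph.cycle\<close> also holds of the closed walk
  \<open>u, v, u\<close> along a single edge; requiring length at least 3 leaves exactly the cycles of the
  undirected graph. A closed walk visits precisely the tails of its arcs.
\<close>

definition hamiltonian :: "('a, 'b) pre_digraph \<Rightarrow> bool" where
  "hamiltonian G \<longleftrightarrow>
     (\<exists>p. pre_digraph.cycle G p \<and> 3 \<le> length p \<and> tail G ` set p = verts G)"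

definition contains_copy :: "('a, 'b) pre_digraph \<Rightarrow> ('c, 'd) pre_digraph \<Rightarrow> bool" where
  "contains_copy G S \<longleftrightarrow> (\<exists>S'. subgraph S' G \<and> digraph_iso S S')"

definition path_arcs :: "'a list \<Rightarrow> 'a rel" where
  "path_arcs xs = set (vwalk_arcs xs) \<union> (set (vwalk_arcs xs))\<inverse>"

text \<open>
  A leg is represented by the list \<open>p\<close> of its vertices other than the root \<open>r\<close>,
  in order of distance from \<open>r\<close>. It is thus the path \<open>r # p\<close>, and its number of edges
  is \<^term>\<open>length p\<close>.
\<close>

definition spider_with_legs :: "'a pair_pre_digraph \<Rightarrow> 'a \<Rightarrow> 'a list list \<Rightarrow> bool" where
  "spider_with_legs S r ps \<longleftrightarrow>
     ps \<noteq> [] \<and> (\<forall>p \<in> set ps. length p \<ge> 1) \<and> distinct (r # concat ps) \<and>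
     pverts S = set (r # concat ps) \<and> parcs S = (\<Union>p \<in> set ps. path_arcs (r # p))"

definition k_spider :: "nat \<Rightarrow> 'a pair_pre_digraph \<Rightarrow> bool" where
  "k_spider k S \<longleftrightarrow> (\<exists>r ps. spider_with_legs S r ps \<and> sum_list (map length ps) = k)"

end

theory Submission
  imports Defs
begin

text \<open>
  Deleting \<open>x\<^sub>0\<close> from the Hamiltonian cycle leaves a path \<open>P\<close> that contains
  all neighbours of \<open>x\<^sub>0\<close>. Root the spider at \<open>x\<^sub>0\<close> and cut the legs off \<open>P\<close> greedily:
  the next leg, with \<open>\<ell>\<close> vertices, occupies the segment of \<open>P\<close> that starts at the first remaining
  neighbour of \<open>x\<^sub>0\<close>. Since it uses at most \<open>\<ell>\<close> neighbours, the number of neighbours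
  still ahead never drops below the total length of the remaining legs, so every leg fits.
\<close>

lemma vwalk_arcs_map: "vwalk_arcs (map f xs) = map (map_prod f f) (vwalk_arcs xs)"
  by (induction xs rule: vwalk_arcs.induct) auto

lemma set_vwalk_arcs_subset: "set (vwalk_arcs xs) \<subseteq> set xs \<times> set xs"
  by (induction xs rule: vwalk_arcs.induct) auto

lemma ex_map_eq_if_distinct:
  assumes "distinct xs" "length xs = length ys"
  shows "\<exists>f. map f xs = ys"
proof
  show "map (\<lambda>x. the (map_of (zip xs ys) x)) xs = ys"
    using assms by (intro nth_equalityI) (auto simp: map_of_zip_nth)
qed

text \<open>Here \<open>N\<close> stands for the neighbours of the root and \<open>xs\<close> for
  the path without it. One injection \<open>f\<close> on all leg vertices encodes disjointness of
  the legs, and \<open>f (hd p) \<in> N\<close> lets each leg be attached to the root. Counting only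
  the neighbours on \<open>xs\<close> lets the induction pass to the suffix behind the segment just
  used.\<close>

lemma greedy_legs:
  assumes "distinct xs" "distinct (concat ps)" "\<forall>p \<in> set ps. p \<noteq> []"
    and "sum_list (map length ps) \<le> card (N \<inter> set xs)"
  shows "\<exists>f. inj_on f (set (concat ps)) \<and> f ` set (concat ps) \<subseteq> set xs \<and>
    (\<forall>p \<in> set ps. f (hd p) \<in> N \<and> set (vwalk_arcs (map f p)) \<subseteq> set (vwalk_arcs xs))"
  using assms
proof (induction ps arbitrary: xs)
  case Nil
  then show ?case by simp
next
  case (Cons p ps)
  define ws ys where "ws = takeWhile (\<lambda>x. x \<notin> N) xs" and "ys = dropWhile (\<lambda>x. x \<notin> N) xs"
  define q zs where "q = take (length p) ys" and "zs = drop (length p) ys"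
  have xs: "xs = ws @ ys" and ys: "ys = q @ zs"
    by (simp_all add: ws_def ys_def q_def zs_def)
  have "N \<inter> set ws = {}"
    by (auto simp: ws_def dest: set_takeWhileD)
  then have N: "N \<inter> set xs = N \<inter> set ys"
    by (auto simp: xs)
  \<comment> \<open>The neighbours left number at least \<open>length p\<close> and all lie on
    \<open>ys\<close>, so \<open>take\<close> is not cut short and \<open>q\<close> has exactly
    \<open>length p\<close> vertices.\<close>
  have "card (N \<inter> set ys) \<le> length ys"
    by (meson Int_lower2 List.finite_set card_length card_mono le_trans)
  then have len: "length q = length p"
    using Cons.prems(4) N by (simp add: q_def)
  have "p \<noteq> []"
    using Cons.prems(3) by simp
  then have "q \<noteq> []"
    using len by auto
  then have "hd q = hd ys" "ys \<noteq> []"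
    by (auto simp: ys)
  then have hd_q: "hd q \<in> N"
    using hd_dropWhile[of "\<lambda>x. x \<notin> N" xs] by (simp add: ys_def)
  have "card (N \<inter> set ys) \<le> card (set q \<union> N \<inter> set zs)"
    by (intro card_mono) (auto simp: ys)
  also have "\<dots> \<le> length p + card (N \<inter> set zs)"
    using card_Un_le[of "set q" "N \<inter> set zs"] card_length[of q] len by linarith
  finally have "sum_list (map length ps) \<le> card (N \<inter> set zs)"
    using Cons.prems(4) N by simp
  moreover have dist: "distinct q" "distinct zs" "set q \<inter> set zs = {}"
    using Cons.prems(1) by (auto simp: xs ys)
  ultimately obtain g where g: "inj_on g (set (concat ps))" "g ` set (concat ps) \<subseteq> set zs"
    "\<forall>p \<in> set ps. g (hd p) \<in> N \<and> set (vwalk_arcs (map g p)) \<subseteq> set (vwalk_arcs zs)"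
    using Cons.IH[of zs] Cons.prems(2,3) by auto
  obtain h where h: "map h p = q"
    using ex_map_eq_if_distinct[of p q] len Cons.prems(2) by auto
  then have h_img: "h ` set p = set q"
    by auto
  have h_inj: "inj_on h (set p)"
    using dist(1) by (simp add: h[symmetric] distinct_map)
  \<comment> \<open>\<open>h\<close> lays the leg \<open>p\<close> along \<open>q\<close>, and
    \<open>g\<close> sends the other legs into \<open>zs\<close>. Both domains and images are
    disjoint, so the glued map stays injective.\<close>
  define f where "f = (\<lambda>v. if v \<in> set p then h v else g v)"
  have f_p: "map f p = q"
    using h by (auto simp: f_def)
  have disj: "set p \<inter> set (concat ps) = {}"
    using Cons.prems(2) by simp
  have f_g: "f v = g v" if "v \<in> set (concat ps)" for v
    using that disj by (auto simp: f_def)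
  have f_h: "f v = h v" if "v \<in> set p" for v
    using that by (simp add: f_def)
  have f_img: "f ` set p = set q" "f ` set (concat ps) \<subseteq> set zs"
    using h_img g(2) f_g f_h by (metis image_cong)+
  have "inj_on f (set p \<union> set (concat ps))"
  proof -
    have "inj_on f (set p)" "inj_on f (set (concat ps))"
      using h_inj g(1) f_g f_h inj_on_cong by metis+
    then show ?thesis
      using f_img dist(3) unfolding inj_on_Un by blast
  qed
  moreover have "f ` (set p \<union> set (concat ps)) \<subseteq> set xs"
    using f_img unfolding image_Un xs ys set_append by blast
  moreover have "f (hd p') \<in> N \<and> set (vwalk_arcs (map f p')) \<subseteq> set (vwalk_arcs xs)"
    if p': "p' \<in> set (p # ps)" for p'
  proof (cases "p' = p")
    case True
    have "f (hd p) = hd q"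
      using \<open>p \<noteq> []\<close> f_p hd_map by metis
    moreover have "set (vwalk_arcs q) \<subseteq> set (vwalk_arcs xs)"
      unfolding xs ys using set_vwalk_arcs_append1 set_vwalk_arcs_append2 by (metis subset_trans)
    ultimately show ?thesis
      using True f_p hd_q by simp
  next
    case False
    with p' have p': "p' \<in> set ps" and "p' \<noteq> []"
      using Cons.prems(3) by auto
    have "f v = g v" if "v \<in> set p'" for v
      using f_g p' that by auto
    then have "map f p' = map g p'" "f (hd p') = g (hd p')"
      using \<open>p' \<noteq> []\<close> by simp_all
    moreover have "set (vwalk_arcs zs) \<subseteq> set (vwalk_arcs xs)"
      unfolding xs ys using set_vwalk_arcs_append2 by (metis subset_trans)
    ultimately show ?thesis
      using g(3) p' by (metis subset_trans)
  qed
  ultimately show ?case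
    by (intro exI[of _ f]) auto
qed

text \<open>The required subgraph is the image of \<open>S\<close> under \<open>f\<close>. Arcs are
  pairs of vertices, so \<open>f\<close> determines the arc map, which inherits injectivity.\<close>

lemma contains_copyI:
  fixes H :: "'a pair_pre_digraph" and S :: "'b pair_pre_digraph"
  assumes "pair_wf_digraph H" "pair_wf_digraph S"
    and inj: "inj_on f (pverts S)"
    and sub: "f ` pverts S \<subseteq> pverts H" "map_prod f f ` parcs S \<subseteq> parcs H"
  shows "contains_copy (with_proj H) (with_proj S)"
proof -
  interpret H: pair_wf_digraph H by fact
  interpret S: pair_wf_digraph S by fact
  \<comment> \<open>The image arcs are again pairs. Taking \<open>fst\<close> and \<open>snd\<close>
    as tail and head makes the image compatible with \<open>H\<close>.\<close>
  define hom where
    "hom = \<lparr>iso_verts = f, iso_arcs = map_prod f f, iso_head = snd, iso_tail = fst\<rparr>"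
  have "parcs S \<subseteq> pverts S \<times> pverts S"
    using S.in_arcsD1 S.in_arcsD2 by auto
  then have "inj_on (map_prod f f) (parcs S)"
    using inj_on_subset[OF map_prod_inj_on[OF inj inj]] by blast
  then have iso: "pre_digraph.digraph_isomorphism (with_proj S) hom"
    using inj S.wf_digraph by (simp add: pre_digraph.digraph_isomorphism_def hom_def)
  then have "wf_digraph (app_iso hom (with_proj S))"
    using S.wf_digraph wf_digraph.wf_digraphI_app_iso by blast
  then have "subgraph (app_iso hom (with_proj S)) (with_proj H)"
    using H.wf_digraph sub by (simp add: subgraph_def compatible_def hom_def)
  moreover have "digraph_iso (with_proj S) (app_iso hom (with_proj S))"
    using iso by (auto simp: digraph_iso_def)
  ultimately show ?thesis
    by (auto simp: contains_copy_def)
qed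

lemma contains_copy_subgraph:
  assumes "contains_copy H S" "subgraph H G"
  shows "contains_copy G S"
  using assms subgraph_trans by (auto simp: contains_copy_def)

lemma spider_pair_wf_digraph:
  assumes "spider_with_legs S r ps"
  shows "pair_wf_digraph S"
proof -
  have "parcs S \<subseteq> pverts S \<times> pverts S"
    using assms set_vwalk_arcs_subset[of "r # p" for p]
    by (fastforce simp: spider_with_legs_def path_arcs_def)
  then show ?thesis
    by unfold_locales auto
qed

text \<open>This translates a cycle, given as a list of arcs, into a list of vertices, which is
  easier to rotate.\<close>

lemma vwalk_arcs_pcas:
  assumes "pcas u p v"
  shows "vwalk_arcs (map fst p @ [v]) = p"
  using assms
proof (induction p arbitrary: u)
  case Nil
  then show ?case by simp
next
  case (Cons e p)
  then show ?case
    by (cases p) (auto simp: prod_eq_iff)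
qed

text \<open>The cycle may start at any vertex \<open>u\<close>. Rotating it to start at
  \<open>x\<close> and dropping the arc that returns to \<open>x\<close> leaves the path.\<close>

lemma hamiltonian_path_from:
  assumes "pair_wf_digraph H" "hamiltonian (with_proj H)" "x \<in> pverts H"
  obtains xs where "distinct (x # xs)" "set (x # xs) = pverts H"
    "set (vwalk_arcs (x # xs)) \<subseteq> parcs H"
proof -
  interpret H: pair_wf_digraph H by fact
  obtain p u where p: "H.awalk u p u" "distinct (tl (pawalk_verts u p))" "p \<noteq> []"
    and verts: "fst ` set p = pverts H"
    using assms(2) by (auto simp: hamiltonian_def H.cycle_def)
  have arcs: "set p \<subseteq> parcs H" and cas: "pcas u p u"
    using p(1) by (auto simp: H.awalk_def)
  have walk: "vwalk_arcs (map fst p @ [u]) = p"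
    using cas by (rule vwalk_arcs_pcas)
  have hd: "hd (map fst p) = u"
    using cas p(3) by (cases p) auto
  have "pawalk_verts w q = map fst q @ [v]" if "pcas w q v" for w q v
    using that by (induction q arbitrary: w) auto
  then have "pawalk_verts u p = map fst p @ [u]"
    using cas .
  \<comment> \<open>Removing the first vertex of the closed walk still leaves \<open>u\<close> at
    its end, so distinctness of the tail covers every vertex of the cycle.\<close>
  then have dist: "distinct (map fst p)"
    using p(2,3) hd by (cases p) auto
  have "x \<in> set (map fst p)"
    using assms(3) verts by simp
  then obtain as bs where split: "map fst p = as @ x # bs"
    by (meson split_list)
  have "set (vwalk_arcs (x # bs @ as)) \<subseteq> set p"
  proof (cases "as = []")
    case True
    then show ?thesis
      using walk split set_vwalk_arcs_append1[of "x # bs" "[u]"] by simp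
  next
    case False
    then have "hd as = u"
      using hd split by simp
    define cs where "cs = x # bs"
    have "vwalk_arcs (as @ cs @ [u]) = p"
      using walk split by (simp add: cs_def)
    then have "set (vwalk_arcs as) \<subseteq> set p" "set (vwalk_arcs (cs @ [u])) \<subseteq> set p"
      using set_vwalk_arcs_append1[of as] set_vwalk_arcs_append2[of "cs @ [u]" as] by auto
    moreover have "cs \<noteq> []"
      by (simp add: cs_def)
    \<comment> \<open>The arc joining \<open>cs\<close> to \<open>as\<close> is the closing arc of
      the cycle, since \<open>as\<close> starts at \<open>u\<close>.\<close>
    ultimately have "set (vwalk_arcs (cs @ as)) \<subseteq> set p"
      using False \<open>hd as = u\<close> by (simp add: vwalk_arcs_append set_vwalk_arcs_snoc)
    then show ?thesis
      by (simp only: cs_def append_Cons)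
  qed
  with arcs have "set (vwalk_arcs (x # bs @ as)) \<subseteq> parcs H"
    by blast
  moreover have "distinct (x # bs @ as)"
    using dist split by auto
  moreover have "set (x # bs @ as) = pverts H"
    using arg_cong[OF split, of set] verts by auto
  ultimately show thesis
    by (rule that[rotated 2])
qed

theorem theorem1:
  fixes G H :: "'a pair_pre_digraph" and S :: "'b pair_pre_digraph"
    and x\<^sub>0 :: 'a and k :: nat
  assumes "k \<ge> 1"
    and "pair_graph G"
    and "pair_graph H" and "subgraph (with_proj H) (with_proj G)"
    and "hamiltonian (with_proj H)"
    and "x\<^sub>0 \<in> pverts H" and "out_degree (with_proj H) x\<^sub>0 \<ge> k"
    and "k_spider k S"
  shows "contains_copy (with_proj H) (with_proj S) \<and> contains_copy (with_proj G) (with_proj S)"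
proof -
  interpret H: pair_graph H by fact
  obtain xs where dist: "distinct (x\<^sub>0 # xs)" and verts: "set (x\<^sub>0 # xs) = pverts H"
    and path: "set (vwalk_arcs (x\<^sub>0 # xs)) \<subseteq> parcs H"
    using hamiltonian_path_from[OF H.pair_wf_digraph_axioms assms(5,6)] .
  obtain r ps where spider: "spider_with_legs S r ps" and k: "sum_list (map length ps) = k"
    using assms(8) by (auto simp: k_spider_def)
  then have legs: "\<forall>p \<in> set ps. p \<noteq> []" "distinct (concat ps)" "r \<notin> set (concat ps)"
    and S: "pverts S = insert r (set (concat ps))" "parcs S = (\<Union>p \<in> set ps. path_arcs (r # p))"
    by (auto simp: spider_with_legs_def)
  define N where "N = {y. (x\<^sub>0, y) \<in> parcs H}"
  \<comment> \<open>Without loops \<open>x\<^sub>0\<close> is not in \<open>N\<close>, and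
    \<open>xs\<close> covers all other vertices of \<open>H\<close>. Hence the full degree counts in
    \<open>greedy_legs\<close>.\<close>
  have "N \<subseteq> set xs"
    using verts H.in_arcsD2 H.pair_no_loops by (fastforce simp: N_def)
  moreover have "out_arcs (with_proj H) x\<^sub>0 = Pair x\<^sub>0 ` N"
    by (auto simp: N_def out_arcs_def)
  then have "card N = out_degree (with_proj H) x\<^sub>0"
    by (simp add: out_degree_def card_image inj_on_def)
  ultimately have "sum_list (map length ps) \<le> card (N \<inter> set xs)"
    using assms(7) k by (simp add: Int_absorb2)
  then obtain g where g: "inj_on g (set (concat ps))" "g ` set (concat ps) \<subseteq> set xs"
    "\<forall>p \<in> set ps. g (hd p) \<in> N \<and> set (vwalk_arcs (map g p)) \<subseteq> set (vwalk_arcs xs)"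
    using greedy_legs[of xs ps N] dist legs by auto
  define f where "f = g(r := x\<^sub>0)"
  have f_g: "f v = g v" if "v \<in> set (concat ps)" for v
    using that legs(3) by (auto simp: f_def)
  have f_img: "f ` set (concat ps) = g ` set (concat ps)"
    using f_g by (rule image_cong[OF refl])
  have "inj_on f (set (concat ps))"
    using g(1) f_g inj_on_cong by metis
  moreover have "f r = x\<^sub>0"
    by (simp add: f_def)
  moreover have "x\<^sub>0 \<notin> f ` set (concat ps)"
    using g(2) dist unfolding f_img by auto
  ultimately have "inj_on f (pverts S)"
    using legs(3) unfolding S(1) by simp
  moreover have "f ` pverts S \<subseteq> pverts H"
    using g(2) verts f_img \<open>f r = x\<^sub>0\<close> unfolding S(1) by auto
  moreover have "map_prod f f ` parcs S \<subseteq> parcs H"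
  proof -
    have "map_prod f f ` set (vwalk_arcs (r # p)) \<subseteq> parcs H" if p: "p \<in> set ps" for p
    proof -
      have "map f p = map g p" "p \<noteq> []" "g (hd p) \<in> N"
        using p f_g legs(1) g(3) by auto
      \<comment> \<open>Only the first arc of a leg can leave the path \<open>xs\<close>; it lies in
        \<open>H\<close> because \<open>g (hd p) \<in> N\<close>.\<close>
      then have "vwalk_arcs (map f (r # p)) = (x\<^sub>0, g (hd p)) # vwalk_arcs (map g p)"
        using \<open>f r = x\<^sub>0\<close> by (simp add: hd_map del: map_eq_conv)
      moreover have "set (vwalk_arcs (map g p)) \<subseteq> parcs H"
        using p g(3) path set_vwalk_arcs_cons by (metis subset_trans)
      ultimately have "set (vwalk_arcs (map f (r # p))) \<subseteq> parcs H"
        using \<open>g (hd p) \<in> N\<close> by (simp add: N_def)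
      then show ?thesis
        by (simp only: vwalk_arcs_map set_map)
    qed
    \<comment> \<open>Symmetry of \<open>H\<close> supplies the reversed arcs contained in
      \<open>path_arcs\<close>.\<close>
    moreover have "(v, u) \<in> parcs H" if "(u, v) \<in> parcs H" for u v
      using that H.pair_sym_arcs by (auto simp: symmetric_def dest: symD)
    ultimately show ?thesis
      unfolding S(2) path_arcs_def by fastforce
  qed
  ultimately have "contains_copy (with_proj H) (with_proj S)"
    using contains_copyI H.pair_wf_digraph_axioms spider_pair_wf_digraph[OF spider] by blast
  then show ?thesis
    using contains_copy_subgraph assms(4) by blast
qed

end
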